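(* Let $G$ be a finite simple graph on $n$ vertices and let $s$ be a positive integer. If $s\leq n-1$, then $\operatorname{dmg}(G; s) \geq s-1$, and if $s\geq n$, then $\operatorname{dmg}(G; s) \geq n-2$.
   Context: All graphs are finite, undirected and simple, and need not be connected. The game with one cop and $s$ robbers on a graph $G$ is a perfect-information game. In round $0$ the cop chooses an initial vertex, and then each robber chooses an initial vertex (several robbers may share a vertex). Each subsequent round consists of a turn for the cop followed by a turn for the robbers; on their turn, each player may stay put or move to a neighboring vertex (on the robbers' turn every uncaptured robber may do so). Whenever the cop occupies the same vertex as one or more robbers, all those robbers are captured and take no further part in the game. If a robber occupies a vertex $v$ at the end of some round (including round $0$) and that robber is not captured in the following round, then $v$ becomes damaged (and stays damaged). The robbers aim to maximize, and the cop aims to minimize, the total number of damaged vertices. The $s$-robber damage number $\operatorname{dmg}(G;s)$ is the number of vertices damaged under optimal play, i.e. the smallest $d$ such that the cop has a strategy guaranteeing that at most $d$ vertices are ever damaged, whatever the $s$ robbers do. *)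

theory Defs
  imports "Graph_Theory.Pair_Digraph"
begin

text \<open>
  A finite simple graph is a \<open>pair_graph\<close>: a finite, loop-free digraph with symmetric arc
  relation \<open>parcs G\<close> on the vertex set \<open>pverts G\<close>.  It need not be connected.
\<close>

text \<open>
  The status of a single robber at the end of a round is \<open>Some v\<close> if it is uncaptured and
  occupies \<open>v\<close>, and \<open>None\<close> once it has been captured.  A configuration lists the status of
  each robber; several robbers may share a vertex.
\<close>

type_synonym 'v config = "'v option list"

text \<open>
  A strategy of the cop maps the configurations at the ends of all rounds played so far,
  oldest first, to the cop's next vertex; in particular \<open>\<sigma> []\<close> is the initial vertex.
  The cop's own earlier positions need not be recorded, as they are determined by the strategy
  and this history.  Thus \<open>\<sigma> h\<close> is the cop's position before, and \<open>\<sigma> (h @ [R])\<close> after,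
  the turn that answers the configuration \<open>R\<close>.
\<close>

type_synonym 'v strategy = "'v config list \<Rightarrow> 'v"

definition cop_strategy :: "'v pair_pre_digraph \<Rightarrow> 'v strategy \<Rightarrow> bool" where
  "cop_strategy G \<sigma> \<longleftrightarrow>
     \<sigma> [] \<in> pverts G \<and>
     (\<forall>h R. \<sigma> (h @ [R]) = \<sigma> h \<or> (\<sigma> h, \<sigma> (h @ [R])) \<in> parcs G)"

text \<open>The status of a robber that has just placed itself on \<open>v\<close> while the cop is on \<open>c\<close>.\<close>

definition arrive :: "'v \<Rightarrow> 'v \<Rightarrow> 'v option" where
  "arrive c v = (if v = c then None else Some v)"

definition robber_start :: "'v pair_pre_digraph \<Rightarrow> 'v \<Rightarrow> 'v option \<Rightarrow> bool" where
  "robber_start G c r \<longleftrightarrow> (\<exists>v\<in>pverts G. r = arrive c v)"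

text \<open>
  \<open>robber_step G c r r'\<close>: after the cop has moved to \<open>c\<close>, a robber of status \<open>r\<close> may have
  status \<open>r'\<close> at the end of the round.  A robber on \<open>c\<close> has been captured by the cop's move and
  has no turn of its own; the others stay put or move to a neighbour, and are captured if they
  enter \<open>c\<close>.
\<close>

definition robber_step ::
    "'v pair_pre_digraph \<Rightarrow> 'v \<Rightarrow> 'v option \<Rightarrow> 'v option \<Rightarrow> bool" where
  "robber_step G c r r' \<longleftrightarrow>
     (case r of
        None \<Rightarrow> r' = None
      | Some u \<Rightarrow>
          if u = c then r' = None
          else (\<exists>v. (v = u \<or> (u, v) \<in> parcs G) \<and> r' = arrive c v))"

text \<open>
  A play of \<open>s\<close> robbers against \<open>\<sigma>\<close> is an infinite sequence of configurations, \<open>R t\<close> being the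
  one at the end of round \<open>t\<close>.
\<close>

definition cop_position :: "'v strategy \<Rightarrow> (nat \<Rightarrow> 'v config) \<Rightarrow> nat \<Rightarrow> 'v" where
  "cop_position \<sigma> R t = \<sigma> (map R [0..<t])"

definition robber_play ::
    "'v pair_pre_digraph \<Rightarrow> nat \<Rightarrow> 'v strategy \<Rightarrow> (nat \<Rightarrow> 'v config) \<Rightarrow> bool" where
  "robber_play G s \<sigma> R \<longleftrightarrow>
     length (R 0) = s \<and>
     (\<forall>r\<in>set (R 0). robber_start G (cop_position \<sigma> R 0) r) \<and>
     (\<forall>t. list_all2 (robber_step G (cop_position \<sigma> R (Suc t))) (R t) (R (Suc t)))"

text \<open>
  A vertex occupied by a robber at the end of round \<open>t\<close> is damaged if that robber is still
  uncaptured at the end of round \<open>t + 1\<close>.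
\<close>

definition damaged :: "(nat \<Rightarrow> 'v config) \<Rightarrow> 'v set" where
  "damaged R =
     {v. \<exists>t i. i < length (R t) \<and> R t ! i = Some v \<and> R (Suc t) ! i \<noteq> None}"

definition guarantees :: "'v pair_pre_digraph \<Rightarrow> nat \<Rightarrow> 'v strategy \<Rightarrow> nat \<Rightarrow> bool" where
  "guarantees G s \<sigma> d \<longleftrightarrow> (\<forall>R. robber_play G s \<sigma> R \<longrightarrow> card (damaged R) \<le> d)"

text \<open>
  For nonempty \<open>G\<close> the minimum below is attained (lemma \<open>dmg_attained\<close>); on the graph without
  vertices the cop has no strategy and the value is unspecified.
\<close>

definition dmg :: "'v pair_pre_digraph \<Rightarrow> nat \<Rightarrow> nat" where
  "dmg G s = (LEAST d. \<exists>\<sigma>. cop_strategy G \<sigma> \<and> guarantees G s \<sigma> d)"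

lemma robber_play_verts:
  assumes G: "pair_graph G" and p: "robber_play G s \<sigma> R"
  shows "i < length (R t) \<Longrightarrow> R t ! i = Some v \<Longrightarrow> v \<in> pverts G"
proof (induction t arbitrary: i v)
  case 0
  then have "robber_start G (cop_position \<sigma> R 0) (Some v)"
    using p unfolding robber_play_def by (metis nth_mem)
  then show ?case by (auto simp: robber_start_def arrive_def split: if_splits)
next
  case (Suc t)
  interpret pair_graph G by (rule G)
  have l: "list_all2 (robber_step G (cop_position \<sigma> R (Suc t))) (R t) (R (Suc t))"
    using p by (auto simp: robber_play_def)
  have i: "i < length (R t)" using l Suc.prems by (simp add: list_all2_lengthD)
  have "robber_step G (cop_position \<sigma> R (Suc t)) (R t ! i) (Some v)"
    using list_all2_nthD[OF l i] Suc.prems by simp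
  then obtain u where "R t ! i = Some u" "v = u \<or> (u, v) \<in> parcs G"
    by (auto simp: robber_step_def arrive_def split: option.splits if_splits)
  then show ?case using Suc.IH[OF i] arc_snd_in_verts[of "(u, v)"] by auto
qed

lemma damaged_subset:
  assumes "pair_graph G" "robber_play G s \<sigma> R"
  shows "damaged R \<subseteq> pverts G"
  using robber_play_verts[OF assms] by (auto simp: damaged_def)

lemma dmg_attained:
  assumes G: "pair_graph G" and ne: "pverts G \<noteq> {}"
  shows "\<exists>\<sigma>. cop_strategy G \<sigma> \<and> guarantees G s \<sigma> (dmg G s)"
proof -
  interpret pair_graph G by (rule G)
  obtain w where "w \<in> pverts G" using ne by blast
  then have "cop_strategy G (\<lambda>_. w)" by (simp add: cop_strategy_def)
  moreover have "guarantees G s (\<lambda>_. w) (card (pverts G))"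
    unfolding guarantees_def using card_mono[OF pair_finite_verts damaged_subset[OF G]] by blast
  ultimately have "\<exists>d \<sigma>. cop_strategy G \<sigma> \<and> guarantees G s \<sigma> d" by blast
  then show ?thesis unfolding dmg_def by (rule LeastI_ex)
qed

end

theory Submission
  imports Defs
begin

text \<open>
  The robbers occupy as many distinct vertices other than the cop's initial vertex as possible
  and never move.  The cop's first move captures the robbers on at most one vertex, so all other
  occupied vertices are already damaged in round 1.
\<close>

primrec static_history :: "'v strategy \<Rightarrow> 'v list \<Rightarrow> nat \<Rightarrow> 'v config list" where
  "static_history \<sigma> vs 0 = [map Some vs]"
| "static_history \<sigma> vs (Suc t) =
     (let h = static_history \<sigma> vs t
      in h @ [map (\<lambda>r. if r = Some (\<sigma> h) then None else r) (last h)])"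

text \<open>A strategy reads the whole history, so the recursion has to build the growing list of
  configurations; the play itself is recovered as the last entry of that list.\<close>

definition static_play :: "'v strategy \<Rightarrow> 'v list \<Rightarrow> nat \<Rightarrow> 'v config" where
  "static_play \<sigma> vs t = last (static_history \<sigma> vs t)"

lemma static_play_0: "static_play \<sigma> vs 0 = map Some vs"
  by (simp add: static_play_def)

text \<open>Links the recursion to \<open>cop_position\<close>: the vertex \<open>\<sigma> h\<close>
  used in building round \<open>t + 1\<close> is the cop's actual position in that round.\<close>

lemma map_static_play: "map (static_play \<sigma> vs) [0..<Suc t] = static_history \<sigma> vs t"
  by (induction t) (simp_all add: static_play_def Let_def)

lemma static_play_Suc:
  "static_play \<sigma> vs (Suc t) =
     map (\<lambda>r. if r = Some (cop_position \<sigma> (static_play \<sigma> vs) (Suc t)) then None else r)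
       (static_play \<sigma> vs t)"
  unfolding cop_position_def map_static_play by (simp add: static_play_def Let_def)

text \<open>Staying put is always legal. Since no robber starts on \<open>\<sigma> []\<close>,
  \<open>arrive\<close> captures nobody in round 0.\<close>

lemma robber_play_static_play:
  assumes "set vs \<subseteq> pverts G - {\<sigma> []}"
  shows "robber_play G (length vs) \<sigma> (static_play \<sigma> vs)"
  unfolding robber_play_def
proof (intro conjI allI)
  show "length (static_play \<sigma> vs 0) = length vs"
    by (simp add: static_play_0)
  show "\<forall>r\<in>set (static_play \<sigma> vs 0). robber_start G (cop_position \<sigma> (static_play \<sigma> vs) 0) r"
    using assms by (auto simp: static_play_0 cop_position_def robber_start_def arrive_def)
  show "list_all2 (robber_step G (cop_position \<sigma> (static_play \<sigma> vs) (Suc t)))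
          (static_play \<sigma> vs t) (static_play \<sigma> vs (Suc t))" for t
    unfolding static_play_Suc
    by (auto simp: list_all2_conv_all_nth robber_step_def arrive_def split: option.splits)
qed

lemma damaged_static_play: "set vs - {\<sigma> [map Some vs]} \<subseteq> damaged (static_play \<sigma> vs)"
proof
  fix v assume v: "v \<in> set vs - {\<sigma> [map Some vs]}"
  then obtain i where "i < length vs" "vs ! i = v"
    by (auto simp: in_set_conv_nth)
  then show "v \<in> damaged (static_play \<sigma> vs)"
    using v unfolding damaged_def mem_Collect_eq
    \<comment> \<open>Round 0 suffices as witness: robber \<open>i\<close> survives round 1 because
      the cop's answer to the initial configuration is not \<open>v\<close>.\<close>
    by (intro exI[of _ 0] exI[of _ i]) (auto simp: static_play_0 static_play_Suc cop_position_def)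
qed

lemma guarantees_ge:
  assumes "pair_graph G" "set vs \<subseteq> pverts G - {\<sigma> []}" "guarantees G (length vs) \<sigma> d"
  shows "card (set vs) - 1 \<le> d"
proof -
  interpret pair_graph G by fact
  have p: "robber_play G (length vs) \<sigma> (static_play \<sigma> vs)"
    using assms(2) by (rule robber_play_static_play)
  have "card (set vs) - 1 \<le> card (set vs - {\<sigma> [map Some vs]})"
    using diff_card_le_card_Diff[of "{\<sigma> [map Some vs]}" "set vs"] by simp
  also have "\<dots> \<le> card (damaged (static_play \<sigma> vs))"
    using damaged_subset[OF assms(1) p] damaged_static_play
    by (metis card_mono finite_subset pair_finite_verts)
  also have "\<dots> \<le> d"
    using assms(3) p by (simp add: guarantees_def)
  finally show ?thesis .
qed

text \<open>Supplies the initial placement. Robbers take distinct vertices while these last; any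
  surplus robbers all share one vertex, which exists because \<open>A\<close> is nonempty.\<close>

lemma obtain_list_spread_over:
  assumes "finite A" "A \<noteq> {}"
  obtains vs where "length vs = s" "set vs \<subseteq> A" "card (set vs) = min s (card A)"
proof -
  obtain xs where xs: "set xs = A" "distinct xs"
    using assms(1) finite_distinct_list by blast
  then have len: "length xs = card A" and "xs \<noteq> []"
    using assms(2) distinct_card by fastforce+
  show thesis
  proof (cases "s \<le> card A")
    case True
    then show thesis
      using xs len that[of "take s xs"] set_take_subset[of s xs] by (simp add: distinct_card)
  next
    case False
    have "set (xs @ replicate (s - length xs) (hd xs)) = A"
      using xs \<open>xs \<noteq> []\<close> by (auto simp: set_replicate_conv_if)
    then show thesis
      using False len that[of "xs @ replicate (s - length xs) (hd xs)"] by simp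
  qed
qed

text \<open>The minimum merges both ranges of \<open>s\<close>: it is \<open>s\<close> when
  \<open>s \<le> n - 1\<close> and \<open>n - 1\<close> when \<open>s \<ge> n\<close>, where
  \<open>n\<close> is the order of the graph.\<close>

lemma dmg_ge:
  assumes "pair_graph G" "pverts G \<noteq> {}"
  shows "min s (card (pverts G) - 1) - 1 \<le> dmg G s"
proof -
  interpret pair_graph G by fact
  obtain \<sigma> where \<sigma>: "cop_strategy G \<sigma>" "guarantees G s \<sigma> (dmg G s)"
    using dmg_attained[OF assms] by blast
  let ?A = "pverts G - {\<sigma> []}"
  have card_A: "card ?A = card (pverts G) - 1"
    using \<sigma>(1) by (simp add: cop_strategy_def)
  show ?thesis
  proof (cases "?A = {}")
    case True
    \<comment> \<open>With a single vertex the robbers have no free place to start, but truncated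
      subtraction makes the bound 0.\<close>
    then have "card (pverts G) - 1 = 0" using card_A by (metis card.empty)
    then show ?thesis by simp
  next
    case False
    then obtain vs where "length vs = s" "set vs \<subseteq> ?A" "card (set vs) = min s (card ?A)"
      by (meson finite_Diff obtain_list_spread_over pair_finite_verts)
    then show ?thesis
      using guarantees_ge[OF assms(1)] \<sigma>(2) card_A by metis
  qed
qed

theorem proposition2p1:
  fixes G :: "'v pair_pre_digraph" and n s :: nat
  assumes "pair_graph G"
    and "card (pverts G) = n"
    and "s > 0"
  shows "(int s \<le> int n - 1 \<longrightarrow> int (dmg G s) \<ge> int s - 1) \<and>
         (s \<ge> n \<longrightarrow> int (dmg G s) \<ge> int n - 2)"
proof (cases "pverts G = {}")
  \<comment> \<open>Here \<open>dmg\<close> is unspecified, but \<open>n = 0\<close> makes the first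
    premise false and the second bound negative.\<close>
  case True
  then show ?thesis using assms(2) by simp
next
  case False
  then show ?thesis using dmg_ge[OF assms(1) False, of s] assms(2) by linarith
qed

end
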